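(* Let $L^*\ge1$, let $\beta^*_1,\dots,\beta^*_{L^*}$ be distinct nonzero complex numbers not on $\mathbb T$, and let $\Phi_n,\Phi^*_n,\Xi_n,\Xi^*_n$ be the bi-orthogonal system of the weight $\widehat w(z)=w(z)/\prod_{j=1}^{L^*}(1-\beta^*_jz^{-1})$. For a sequence $a=(a_m)$ let $v(a,z)=\big(a_{n-L^*}(z),a_{n-L^*+1}(z),\dots,a_n(z)\big)$, and let $\det(v_0;\dots;v_N)$ be the determinant with rows $v_0,\dots,v_N$. Then for each $n\ge L^*$ there are constants $C,C^*$ independent of $z$ such that $$\Phi_n(z)=C\det\big(v(\phi,z);(\beta^*_1)^{-n}v(\xi,\beta^*_1);\dots;(\beta^*_{L^*})^{-n}v(\xi,\beta^*_{L^*})\big),$$ $$\Phi^*_n(z)=C^*\det\big(v(\phi^*,z);(\beta^*_1)^{-n}v(\xi^*,\beta^*_1);\dots;(\beta^*_{L^*})^{-n}v(\xi^*,\beta^*_{L^*})\big),$$ $$\prod_{j=1}^{L^*}(1-\beta^*_jz^{-1})\,\Xi_n(z)=C\det\big(v(\xi,z);(\beta^*_1)^{-n}v(\xi,\beta^*_1);\dots;(\beta^*_{L^*})^{-n}v(\xi,\beta^*_{L^*})\big),$$ $$\prod_{j=1}^{L^*}(1-\beta^*_jz^{-1})\,\Xi^*_n(z)=C^*\det\big(v(\xi^*,z);(\beta^*_1)^{-n}v(\xi^*,\beta^*_1);\dots;(\beta^*_{L^*})^{-n}v(\xi^*,\beta^*_{L^*})\big).$$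
   Context: $\mathbb T$ is the unit circle. For a complex-valued weight $w$ on $\mathbb T$ put $w_k=\int_{\mathbb T}\frac{d\zeta}{2\pi i\zeta}w(\zeta)\zeta^{-k}$ and $I_n[w]=\det[w_{j-k}]_{j,k=0,\dots,n-1}$, $I_0=1$. If $I_n[w]\ne0$ for all $n\ge0$, the bi-orthogonal system of $w$ is: polynomials $\phi_n,\bar\phi_n$ of degree $n$ with the same leading coefficient $\kappa_n$ satisfying $\int_{\mathbb T}\frac{d\zeta}{2\pi i\zeta}w(\zeta)\phi_m(\zeta)\bar\phi_n(\bar\zeta)=\delta_{m,n}$ with $\bar\zeta=1/\zeta$ ($\bar\phi_n$ is a separate polynomial, not in general the complex conjugate of $\phi_n$; $\kappa_n^2=I_n/I_{n+1}$, with a choice of square root $\kappa_n$ fixed); the reciprocal polynomial $\phi^*_n(z)=z^n\bar\phi_n(1/z)$; and the associated functions, for $z\notin\mathbb T$ and $n>0$, $\xi_n(z)=\int_{\mathbb T}\frac{d\zeta}{2\pi i\zeta}\frac{\zeta+z}{\zeta-z}w(\zeta)\phi_n(\zeta)$, $\ \xi^*_n(z)=-z^n\int_{\mathbb T}\frac{d\zeta}{2\pi i\zeta}\frac{\zeta+z}{\zeta-z}w(\zeta)\bar\phi_n(\bar\zeta)=\frac1{\kappa_n}-\int_{\mathbb T}\frac{d\zeta}{2\pi i\zeta}\frac{\zeta+z}{\zeta-z}w(\zeta)\phi^*_n(\zeta)$, and $\xi_0(z)=\kappa_0[w_0+F(z)]$, $\xi^*_0(z)=\kappa_0[w_0-F(z)]$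 with $F(z)=\int_{\mathbb T}\frac{d\zeta}{2\pi i\zeta}\frac{\zeta+z}{\zeta-z}w(\zeta)$. Set $r_n=\phi_n(0)/\kappa_n$, $\bar r_n=\bar\phi_n(0)/\kappa_n$. The same definitions and normalisation applied to a modified weight $\widehat w$ give $\Phi_n,\bar\Phi_n,\Phi^*_n,\Xi_n,\Xi^*_n$, leading coefficient $\widehat\kappa_n$, and $\widehat r_n,\widehat{\bar r}_n$. Standing generic assumptions: both the original and the modified bi-orthogonal systems exist, and $r_n\bar r_n\ne0,1$, $\widehat r_n\widehat{\bar r}_n\ne0,1$ for all $n\ge1$. *)

theory Defs
  imports "HOL-Complex_Analysis.Complex_Analysis" "Jordan_Normal_Form.Determinant"
begin

text \<open>
  A weight is a function on the complex plane of which only the restriction to the unit circle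
  matters. The only regularity imposed on it is Lebesgue integrability over the circle, which is
  what makes all the integrals below exist.
\<close>

definition weight :: "(complex \<Rightarrow> complex) \<Rightarrow> bool" where
  "weight w \<longleftrightarrow> (\<lambda>t. w (circlepath 0 1 t)) absolutely_integrable_on {0..1}"

definition circle_mean :: "(complex \<Rightarrow> complex) \<Rightarrow> complex" where
  "circle_mean f = contour_integral (circlepath 0 1) (\<lambda>\<zeta>. f \<zeta> / (2 * of_real pi * \<i> * \<zeta>))"

definition fourier_coeff :: "(complex \<Rightarrow> complex) \<Rightarrow> int \<Rightarrow> complex" where
  "fourier_coeff w k = circle_mean (\<lambda>\<zeta>. w \<zeta> * \<zeta> powi (- k))"

definition toeplitz_det :: "(complex \<Rightarrow> complex) \<Rightarrow> nat \<Rightarrow> complex" where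
  "toeplitz_det w n =
     Determinant.det (Matrix.mat n n (\<lambda>(j, k). fourier_coeff w (int j - int k)))"

text \<open>
  In \<open>biorthogonal_system w \<kappa> \<phi> \<psi>\<close> the polynomial \<open>\<psi> n\<close> is the partner usually written as
  \<open>\<phi> n\<close> with a bar; it is not the complex conjugate of \<open>\<phi> n\<close> in general. The sequence
  \<open>\<kappa>\<close> records the choice of square roots.
\<close>

definition biorthogonal_system ::
  "(complex \<Rightarrow> complex) \<Rightarrow> (nat \<Rightarrow> complex) \<Rightarrow> (nat \<Rightarrow> complex poly) \<Rightarrow> (nat \<Rightarrow> complex poly) \<Rightarrow> bool"
  where
  "biorthogonal_system w \<kappa> \<phi> \<psi> \<longleftrightarrow>
     (\<forall>n. toeplitz_det w n \<noteq> 0) \<and>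
     (\<forall>n. degree (\<phi> n) = n \<and> degree (\<psi> n) = n) \<and>
     (\<forall>n. lead_coeff (\<phi> n) = \<kappa> n \<and> lead_coeff (\<psi> n) = \<kappa> n) \<and>
     (\<forall>n. (\<kappa> n)\<^sup>2 = toeplitz_det w n / toeplitz_det w (Suc n)) \<and>
     (\<forall>m n. circle_mean (\<lambda>\<zeta>. w \<zeta> * poly (\<phi> m) \<zeta> * poly (\<psi> n) (1 / \<zeta>)) = (if m = n then 1 else 0))"

definition refl_coeff :: "(nat \<Rightarrow> complex) \<Rightarrow> (nat \<Rightarrow> complex poly) \<Rightarrow> nat \<Rightarrow> complex" where
  "refl_coeff \<kappa> p n = poly (p n) 0 / \<kappa> n"

definition generic_system ::
  "(nat \<Rightarrow> complex) \<Rightarrow> (nat \<Rightarrow> complex poly) \<Rightarrow> (nat \<Rightarrow> complex poly) \<Rightarrow> bool"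
  where
  "generic_system \<kappa> \<phi> \<psi> \<longleftrightarrow>
     (\<forall>n\<ge>1. refl_coeff \<kappa> \<phi> n * refl_coeff \<kappa> \<psi> n \<noteq> 0 \<and> refl_coeff \<kappa> \<phi> n * refl_coeff \<kappa> \<psi> n \<noteq> 1)"

text \<open>
  Since \<open>\<psi> n\<close> has degree exactly \<open>n\<close>, the library's \<open>reflect_poly\<close> gives the reciprocal
  polynomial \<open>z ^ n * \<psi> n (1 / z)\<close>, with the correct value at \<open>z = 0\<close> as well.
\<close>

definition recip :: "(nat \<Rightarrow> complex poly) \<Rightarrow> nat \<Rightarrow> complex poly" where
  "recip \<psi> n = reflect_poly (\<psi> n)"

definition herglotz :: "(complex \<Rightarrow> complex) \<Rightarrow> complex \<Rightarrow> complex" where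
  "herglotz w z = circle_mean (\<lambda>\<zeta>. (\<zeta> + z) / (\<zeta> - z) * w \<zeta>)"

text \<open>The associated functions are meaningful only for \<open>z\<close> off the unit circle.\<close>

definition assoc_fun ::
  "(complex \<Rightarrow> complex) \<Rightarrow> (nat \<Rightarrow> complex) \<Rightarrow> (nat \<Rightarrow> complex poly) \<Rightarrow> nat \<Rightarrow> complex \<Rightarrow> complex"
  where
  "assoc_fun w \<kappa> \<phi> n z =
     (if n = 0 then \<kappa> 0 * (fourier_coeff w 0 + herglotz w z)
      else circle_mean (\<lambda>\<zeta>. (\<zeta> + z) / (\<zeta> - z) * w \<zeta> * poly (\<phi> n) \<zeta>))"

definition assoc_fun_star ::
  "(complex \<Rightarrow> complex) \<Rightarrow> (nat \<Rightarrow> complex) \<Rightarrow> (nat \<Rightarrow> complex poly) \<Rightarrow> nat \<Rightarrow> complex \<Rightarrow> complex"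
  where
  "assoc_fun_star w \<kappa> \<psi> n z =
     (if n = 0 then \<kappa> 0 * (fourier_coeff w 0 - herglotz w z)
      else - (z ^ n) * circle_mean (\<lambda>\<zeta>. (\<zeta> + z) / (\<zeta> - z) * w \<zeta> * poly (\<psi> n) (1 / \<zeta>)))"

definition denom_factor :: "nat \<Rightarrow> (nat \<Rightarrow> complex) \<Rightarrow> complex \<Rightarrow> complex" where
  "denom_factor L \<beta> z = (\<Prod>j = 1..L. 1 - \<beta> j * inverse z)"

definition modified_weight ::
  "(complex \<Rightarrow> complex) \<Rightarrow> nat \<Rightarrow> (nat \<Rightarrow> complex) \<Rightarrow> complex \<Rightarrow> complex"
  where
  "modified_weight w L \<beta> z = w z / denom_factor L \<beta> z"

text \<open>
  Row 0 is \<open>v(a, z)\<close>; row \<open>j\<close>, for \<open>1 \<le> j \<le> L\<close>, is \<open>v(b, \<beta> j)\<close> scaled by the \<open>-n\<close>-th power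
  of \<open>\<beta> j\<close>, where \<open>v(c, x)\<close> has the entries \<open>c (n - L + k) x\<close> for \<open>k = 0, ..., L\<close>. It is
  to be used only for \<open>L \<le> n\<close>.
\<close>

definition casorati_det ::
  "nat \<Rightarrow> nat \<Rightarrow> (nat \<Rightarrow> complex) \<Rightarrow> (nat \<Rightarrow> complex \<Rightarrow> complex) \<Rightarrow> (nat \<Rightarrow> complex \<Rightarrow> complex) \<Rightarrow> complex \<Rightarrow> complex"
  where
  "casorati_det L n \<beta> a b z =
     Determinant.det (Matrix.mat (L + 1) (L + 1)
       (\<lambda>(j, k). if j = 0 then a (n - L + k) z
                 else \<beta> j powi (- int n) * b (n - L + k) (\<beta> j)))"

end

theory Submission
  imports Defs
begin

text \<open>
  Write \<open>\<langle>f\<rangle>\<close> and \<open>\<langle>f\<rangle>'\<close> for the mean of \<open>f\<close> against the original and the modified weight. For all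
  \<open>m \<ge> 0\<close> one has \<open>\<xi>\<^sub>m(z) = 2 \<langle>\<phi>\<^sub>m / (1 - z/\<zeta>)\<rangle>\<close> and \<open>\<xi>\<^sup>*\<^sub>m(z) = -2 z \<langle>\<zeta>\<inverse> \<phi>\<^sup>*\<^sub>m / (1 - z/\<zeta>)\<rangle>\<close>, so the
  starred statement is the plain one for the weights multiplied by \<open>\<zeta>\<inverse>\<close>.

  Expanding the determinant along its first row gives a combination \<open>p\<close> of
  \<open>\<phi>\<^bsub>n-L\<^esub>, \<dots>, \<phi>\<^sub>n\<close> with \<open>\<langle>p / (1 - \<beta>\<^sub>j/\<zeta>)\<rangle> = 0\<close> for every \<open>j\<close>, and \<open>\<langle>p \<zeta>\<^bsup>-k\<^esup>\<rangle> = 0\<close> for \<open>k < n - L\<close>. By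
  partial fractions these say \<open>\<langle>p \<zeta>\<^bsup>-k\<^esup>\<rangle>' = 0\<close> for \<open>k < n\<close>, hence \<open>p\<close> is a multiple of \<open>\<Phi>\<^sub>n\<close>. The same
  argument shows that the linear system on the coefficients has an at most one-dimensional solution
  space, so its minors do not all vanish and \<open>p \<noteq> 0\<close>. Finally, the denominator \<open>D\<close> satisfies
  \<open>\<langle>\<Phi>\<^sub>n / (1 - z/\<zeta>)\<rangle> = D(z) \<langle>\<Phi>\<^sub>n / (1 - z/\<zeta>)\<rangle>'\<close> because \<open>(D(\<zeta>) - D(z)) / (1 - z/\<zeta>)\<close> is a polynomial
  of degree less than \<open>n\<close> in \<open>1/\<zeta>\<close>.
\<close>

section \<open>Circle means and the linear pairing attached to a weight\<close>

lemma circle_mean_eq_integral: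
  "circle_mean f = integral {0..1} (\<lambda>t. f (circlepath 0 1 t))"
proof -
  have "vector_derivative (circlepath 0 1) (at t) = 2 * of_real pi * \<i> * circlepath 0 1 t" for t
    by (simp only: vector_derivative_circlepath) (simp add: circlepath)
  moreover have "circlepath 0 1 t \<noteq> 0" for t
    by (simp add: circlepath)
  ultimately show ?thesis
    unfolding circle_mean_def contour_integral_integral by simp
qed

lemma circle_mean_cong:
  assumes "\<And>\<zeta>. \<zeta> \<in> sphere 0 1 \<Longrightarrow> f \<zeta> = g \<zeta>"
  shows "circle_mean f = circle_mean g"
  unfolding circle_mean_eq_integral
proof (rule integral_cong)
  fix t
  have "circlepath 0 1 t \<in> sphere 0 1"
    by (simp add: circlepath norm_mult)
  then show "f (circlepath 0 1 t) = g (circlepath 0 1 t)"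
    by (rule assms)
qed

text \<open>A continuous function on the compact circle is bounded and measurable, and such a factor
  preserves absolute integrability. This supplies the integrability of all integrands below and
  allows factors such as \<open>1 / \<zeta>\<close> to be absorbed into the weight.\<close>

lemma weight_mult:
  assumes w: "weight w" and g: "continuous_on (sphere 0 1) g"
  shows "weight (\<lambda>\<zeta>. w \<zeta> * g \<zeta>)"
proof -
  have "(circlepath 0 1) ` {0..1} \<subseteq> sphere (0::complex) 1"
    by (auto simp: circlepath norm_mult)
  then have cont: "continuous_on {0..1} (\<lambda>t. g (circlepath 0 1 t))"
    by (intro continuous_on_compose2[OF g])
       (auto simp: circlepath intro!: continuous_intros)
  have "(\<lambda>t. g (circlepath 0 1 t) * w (circlepath 0 1 t)) absolutely_integrable_on {0..1}"
  proof (rule absolutely_integrable_bounded_measurable_product[where h = "(*)"])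
    show "bilinear ((*) :: complex \<Rightarrow> complex \<Rightarrow> complex)"
      using bilinear_times .
    show "(\<lambda>t. g (circlepath 0 1 t)) \<in> borel_measurable (lebesgue_on {0..1})"
      by (rule continuous_imp_measurable_on_sets_lebesgue[OF cont]) simp
    show "bounded ((\<lambda>t. g (circlepath 0 1 t)) ` {0..1})"
      using compact_continuous_image[OF cont] compact_imp_bounded by blast
    show "(\<lambda>t. w (circlepath 0 1 t)) absolutely_integrable_on {0..1}"
      using w by (simp add: weight_def)
  qed simp
  then show ?thesis
    by (simp add: weight_def mult.commute)
qed

text \<open>The bracket of the overview with its weight made explicit, so that factors can be moved
  between weight and integrand.\<close>

definition pairing :: "(complex \<Rightarrow> complex) \<Rightarrow> (complex \<Rightarrow> complex) \<Rightarrow> complex" where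
  "pairing w g = circle_mean (\<lambda>\<zeta>. w \<zeta> * g \<zeta>)"

lemma pairing_cong:
  assumes "\<And>\<zeta>. \<zeta> \<in> sphere 0 1 \<Longrightarrow> f \<zeta> = g \<zeta>"
  shows "pairing w f = pairing w g"
  unfolding pairing_def by (rule circle_mean_cong) (simp add: assms)

lemma pairing_integrable:
  assumes "weight w" "continuous_on (sphere 0 1) g"
  shows "(\<lambda>t. w (circlepath 0 1 t) * g (circlepath 0 1 t)) integrable_on {0..1}"
  using weight_mult[OF assms] absolutely_integrable_on_def
  unfolding weight_def by blast

lemma pairing_add:
  assumes "weight w" "continuous_on (sphere 0 1) f" "continuous_on (sphere 0 1) g"
  shows "pairing w (\<lambda>\<zeta>. f \<zeta> + g \<zeta>) = pairing w f + pairing w g"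
  unfolding pairing_def circle_mean_eq_integral distrib_left
  by (intro integral_add pairing_integrable assms)

lemma pairing_cmult: "pairing w (\<lambda>\<zeta>. c * g \<zeta>) = c * pairing w g"
  unfolding pairing_def circle_mean_eq_integral
  by (subst integral_mult_right[symmetric]) (simp add: mult.left_commute)

lemma pairing_zero: "pairing w (\<lambda>\<zeta>. 0) = 0"
  using pairing_cmult[of w 0 "\<lambda>_. 0"] by simp

lemma pairing_sum:
  assumes "weight w" "finite I" "\<And>i. i \<in> I \<Longrightarrow> continuous_on (sphere 0 1) (g i)"
  shows "pairing w (\<lambda>\<zeta>. \<Sum>i\<in>I. c i * g i \<zeta>) = (\<Sum>i\<in>I. c i * pairing w (g i))"
  using assms(2,3)
proof (induction I)
  case empty
  then show ?case by (simp add: pairing_zero)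
next
  case (insert i I)
  then show ?case
    by (simp add: pairing_add[OF assms(1)] pairing_cmult continuous_intros)
qed

lemma pairing_diff:
  assumes "weight w" "continuous_on (sphere 0 1) f" "continuous_on (sphere 0 1) g"
  shows "pairing w (\<lambda>\<zeta>. f \<zeta> - g \<zeta>) = pairing w f - pairing w g"
  unfolding pairing_def circle_mean_eq_integral right_diff_distrib
  by (intro integral_diff pairing_integrable assms)

lemma pairing_weight_mult: "pairing (\<lambda>\<zeta>. w \<zeta> * h \<zeta>) g = pairing w (\<lambda>\<zeta>. h \<zeta> * g \<zeta>)"
  by (simp add: pairing_def mult.assoc)

section \<open>Polynomial bases graded by degree, and abstract biorthogonality\<close>

text \<open>Subtracting the multiple of \<open>P (Suc n)\<close> that cancels the top coefficient
  lowers the degree bound, so induction applies.\<close>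

lemma poly_expansion:
  fixes P :: "nat \<Rightarrow> 'a :: field poly"
  assumes deg: "\<And>k. degree (P k) = k" and nz: "\<And>k. P k \<noteq> 0"
  shows "degree q \<le> n \<Longrightarrow> \<exists>c. q = (\<Sum>k\<le>n. Polynomial.smult (c k) (P k))"
proof (induction n arbitrary: q)
  case 0
  obtain a b where a: "q = [:a:]" and b: "P 0 = [:b:]"
    using 0 deg[of 0] by (metis degree_eq_zeroE le_zero_eq)
  have "b \<noteq> 0" using nz[of 0] b by auto
  then show ?case
    by (intro exI[of _ "\<lambda>_. a / b"]) (simp add: a b)
next
  case (Suc n)
  define x where "x = coeff q (Suc n) / lead_coeff (P (Suc n))"
  have l: "lead_coeff (P (Suc n)) \<noteq> 0" using nz by simp
  have "degree (q - Polynomial.smult x (P (Suc n))) \<le> n"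
  proof (rule degree_le, intro allI impI)
    fix i assume "n < i"
    then consider "i = Suc n" | "i > Suc n" by linarith
    then show "coeff (q - Polynomial.smult x (P (Suc n))) i = 0"
    proof cases
      case 1
      then show ?thesis using l deg[of "Suc n"] by (simp add: x_def)
    next
      case 2
      then show ?thesis using Suc.prems deg[of "Suc n"] by (simp add: coeff_eq_0)
    qed
  qed
  then obtain c where c: "q - Polynomial.smult x (P (Suc n)) = (\<Sum>k\<le>n. Polynomial.smult (c k) (P k))"
    using Suc.IH by blast
  show ?case
    by (intro exI[of _ "c(Suc n := x)"]) (simp add: c[symmetric])
qed

text \<open>Only the last summand reaches the top degree, so its coefficient vanishes; then descend.
  The offset \<open>m\<close> serves the window of indices from \<open>n - L\<close> to
  \<open>n\<close>.\<close>

lemma poly_independent: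
  fixes P :: "nat \<Rightarrow> 'a :: field poly"
  assumes deg: "\<And>k. degree (P k) = k" and nz: "\<And>k. P k \<noteq> 0"
    and "(\<Sum>k\<le>n. Polynomial.smult (c k) (P (m + k))) = 0" "k \<le> n"
  shows "c k = 0"
  using assms(3,4)
proof (induction n arbitrary: k)
  case 0
  then show ?case using nz[of m] by simp
next
  case (Suc n)
  have "coeff (\<Sum>k\<le>n. Polynomial.smult (c k) (P (m + k))) (m + Suc n) = 0"
    using deg by (simp add: coeff_sum coeff_eq_0)
  then have "c (Suc n) * coeff (P (m + Suc n)) (m + Suc n) = 0"
    using arg_cong[OF Suc.prems(1), of "\<lambda>p. coeff p (m + Suc n)"] by simp
  then have top: "c (Suc n) = 0"
    using nz[of "m + Suc n"] deg[of "m + Suc n"] by (metis leading_coeff_0_iff mult_eq_0_iff)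
  have "(\<Sum>k\<le>n. Polynomial.smult (c k) (P (m + k))) = 0" using Suc.prems(1) top by simp
  with Suc top show ?case by (cases "k = Suc n") auto
qed

text \<open>The form \<open>B\<close> is kept abstract so that the result can be used again with its
  two arguments exchanged. For the first claim, expand \<open>q\<close> in the \<open>Q k\<close>
  with \<open>k < n\<close>. For the second, the coefficient of \<open>P k\<close> in
  \<open>p\<close> is \<open>B p (Q k)\<close>, and \<open>Q k\<close> is a combination of monomials
  of degree at most \<open>k\<close>.\<close>

lemma biorthogonal_polys:
  fixes B :: "'a :: field poly \<Rightarrow> 'a poly \<Rightarrow> 'a"
  assumes addl: "\<And>p p' q. B (p + p') q = B p q + B p' q"
    and smultl: "\<And>c p q. B (Polynomial.smult c p) q = c * B p q"
    and addr: "\<And>p q q'. B p (q + q') = B p q + B p q'"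
    and smultr: "\<And>c p q. B p (Polynomial.smult c q) = c * B p q"
    and P: "\<And>k. degree (P k) = k" "\<And>k. P k \<noteq> 0"
    and Q: "\<And>k. degree (Q k) = k" "\<And>k. Q k \<noteq> 0"
    and orth: "\<And>m n. B (P m) (Q n) = (if m = n then 1 else 0)"
  shows "degree q < n \<Longrightarrow> B (P n) q = 0"
    and "degree p \<le> n \<Longrightarrow> (\<And>k. k < n \<Longrightarrow> B p (Polynomial.monom 1 k) = 0) \<Longrightarrow> \<exists>c. p = Polynomial.smult c (P n)"
proof -
  have B0l: "B 0 q = 0" for q using smultl[of 0] by simp
  have B0r: "B p 0 = 0" for p using smultr[of _ 0] by simp
  have suml: "B (\<Sum>k\<in>I. Polynomial.smult (c k) (f k)) q = (\<Sum>k\<in>I. c k * B (f k) q)" if "finite I" for I c f q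
    using that by (induction I) (simp_all add: B0l addl smultl)
  have sumr: "B p (\<Sum>k\<in>I. Polynomial.smult (c k) (f k)) = (\<Sum>k\<in>I. c k * B p (f k))" if "finite I" for I c f p
    using that by (induction I) (simp_all add: B0r addr smultr)
  show "B (P n) q = 0" if "degree q < n"
  proof -
    have "degree q \<le> n - 1" using that by simp
    from poly_expansion[of Q, OF Q this] obtain c
      where "q = (\<Sum>k\<le>n-1. Polynomial.smult (c k) (Q k))" by blast
    then have "B (P n) q = (\<Sum>k\<le>n-1. c k * B (P n) (Q k))"
      by (simp only: sumr finite_atMost)
    also have "\<dots> = 0"
      using that by (intro sum.neutral) (auto simp: orth)
    finally show ?thesis .
  qed
  show "\<exists>c. p = Polynomial.smult c (P n)"
    if deg: "degree p \<le> n" and p: "\<And>k. k < n \<Longrightarrow> B p (Polynomial.monom 1 k) = 0"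
  proof -
    obtain c where c: "p = (\<Sum>k\<le>n. Polynomial.smult (c k) (P k))"
      using poly_expansion[of P, OF P deg] by blast
    have "c k = 0" if "k < n" for k
    proof -
      have "Q k = (\<Sum>i\<le>k. Polynomial.smult (coeff (Q k) i) (Polynomial.monom 1 i))"
        using poly_as_sum_of_monoms[of "Q k"] by (simp add: Q(1) smult_monom)
      from arg_cong[OF this, of "B p"]
      have "B p (Q k) = (\<Sum>i\<le>k. coeff (Q k) i * B p (Polynomial.monom 1 i))"
        by (simp only: sumr finite_atMost)
      also have "\<dots> = 0" using p that by simp
      finally show ?thesis
        using that by (simp add: c suml orth if_distrib[of "(*) _"] cong: if_cong)
    qed
    then have "p = Polynomial.smult (c n) (P n)"
      by (simp add: c flip: lessThan_Suc_atMost)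
    then show ?thesis ..
  qed
qed

section \<open>Determinants as linear forms in their first row\<close>

text \<open>The witness \<open>h\<close> consists of the cofactors of row 0, which do not depend on
  that row. The hypothesis says that the system given by the other rows has a solution space of
  dimension at most one; this is what prevents all cofactors from vanishing.\<close>

lemma det_row_zero_cofactors:
  fixes b :: "nat \<Rightarrow> nat \<Rightarrow> 'a :: field"
  assumes line: "\<forall>u v i. (\<forall>j\<in>{1..L}. (\<Sum>k\<le>L. u k * b j k) = 0) \<longrightarrow>
      (\<forall>j\<in>{1..L}. (\<Sum>k\<le>L. v k * b j k) = 0) \<longrightarrow> i \<le> L \<longrightarrow> u i \<noteq> 0 \<longrightarrow> v i = 0 \<longrightarrow>
      (\<forall>k\<le>L. v k = 0)"
  shows "\<exists>h.
    (\<forall>r. Determinant.det (Matrix.mat (L + 1) (L + 1) (\<lambda>(j, k). if j = 0 then r k else b j k))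
        = (\<Sum>k\<le>L. h k * r k)) \<and>
    (\<forall>j\<in>{1..L}. (\<Sum>k\<le>L. h k * b j k) = 0) \<and> (\<exists>k\<le>L. h k \<noteq> 0)"
proof -
  define M where "M r = Matrix.mat (L + 1) (L + 1) (\<lambda>(j, k). if j = 0 then r k else b j k)" for r
  have M: "M r \<in> carrier_mat (L + 1) (L + 1)" for r by (simp add: M_def)
  define h where "h k = cofactor (M (\<lambda>_. 0)) 0 k" for k
  have del: "mat_delete (M r) 0 k = mat_delete (M (\<lambda>_. 0)) 0 k" if "k \<le> L" for r k
    by (rule eq_matI) (simp_all add: M_def mat_delete_def)
  have cof: "cofactor (M r) 0 k = h k" if "k \<le> L" for r k
    unfolding h_def cofactor_def del[OF that, of r] ..
  have det: "Determinant.det (M r) = (\<Sum>k\<le>L. h k * r k)" for r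
  proof -
    have "Determinant.det (M r) = (\<Sum>k<L + 1. M r $$ (0, k) * cofactor (M r) 0 k)"
      by (rule laplace_expansion_row[OF M]) simp
    also have "\<dots> = (\<Sum>k\<le>L. h k * r k)"
    proof (rule sum.cong)
      fix k assume "k \<in> {..L}"
      moreover from this have "M r $$ (0, k) = r k" by (simp add: M_def)
      ultimately show "M r $$ (0, k) * cofactor (M r) 0 k = h k * r k" by (simp add: cof)
    qed auto
    finally show ?thesis .
  qed
  have ker: "(\<Sum>k\<le>L. h k * b j k) = 0" if "j \<in> {1..L}" for j
  proof -
    \<comment> \<open>Putting \<open>b j\<close> into row 0 repeats row \<open>j\<close>, and the
      Laplace expansion of this zero determinant is the desired relation.\<close>
    have "Determinant.det (M (b j)) = 0"
      by (rule det_identical_rows[OF M, of 0 j]) (use that in \<open>auto simp: M_def intro!: eq_vecI\<close>)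
    then show ?thesis by (simp add: det)
  qed
  have "\<exists>k\<le>L. h k \<noteq> 0"
  proof (rule ccontr)
    assume "\<not> (\<exists>k\<le>L. h k \<noteq> 0)"
    then have "Determinant.det (M r) = 0" for r by (simp add: det)
    then have "\<exists>v. v \<in> carrier_vec (L + 1) \<and> v \<noteq> 0\<^sub>v (L + 1) \<and> M r *\<^sub>v v = 0\<^sub>v (L + 1)" for r
      using det_0_iff_vec_prod_zero[OF M] by blast
    then have ex: "\<exists>u. (\<exists>k\<le>L. u k \<noteq> 0) \<and> (\<Sum>k\<le>L. u k * r k) = 0 \<and>
        (\<forall>j\<in>{1..L}. (\<Sum>k\<le>L. u k * b j k) = 0)" for r
    proof -
      obtain v where v: "v \<in> carrier_vec (L + 1)" "v \<noteq> 0\<^sub>v (L + 1)" "M r *\<^sub>v v = 0\<^sub>v (L + 1)"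
        using \<open>\<And>r. \<exists>v. v \<in> carrier_vec (L + 1) \<and> v \<noteq> 0\<^sub>v (L + 1) \<and> M r *\<^sub>v v = 0\<^sub>v (L + 1)\<close> by blast
      have "\<exists>k\<le>L. vec_index v k \<noteq> 0"
      proof (rule ccontr)
        assume "\<not> (\<exists>k\<le>L. vec_index v k \<noteq> 0)"
        then have "v = 0\<^sub>v (L + 1)" using v(1) by (intro eq_vecI) auto
        with v(2) show False by simp
      qed
      moreover have "(\<Sum>k\<le>L. vec_index v k * (if j = 0 then r k else b j k)) = 0" if "j \<le> L" for j
      proof -
        have "0 = vec_index (M r *\<^sub>v v) j" using v(3) that by simp
        also have "\<dots> = (\<Sum>k = 0..<L + 1. (if j = 0 then r k else b j k) * vec_index v k)"
          using that v(1) by (simp add: M_def scalar_prod_def)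
        also have "\<dots> = (\<Sum>k\<le>L. vec_index v k * (if j = 0 then r k else b j k))"
          by (rule sum.cong) (auto simp: mult.commute)
        finally show ?thesis by simp
      qed
      from this[of 0] this have "(\<Sum>k\<le>L. vec_index v k * r k) = 0"
        "\<forall>j\<in>{1..L}. (\<Sum>k\<le>L. vec_index v k * b j k) = 0" by force+
      ultimately show ?thesis by blast
    qed
    \<comment> \<open>With all cofactors zero the matrix is singular for every first row. The zero
      row gives a nontrivial solution \<open>u\<close> with \<open>u i\<close> nonzero; the unit row
      at \<open>i\<close> then gives a nontrivial solution \<open>v\<close> with
      \<open>v i = 0\<close>, against \<open>line\<close>.\<close>
    obtain u i where u: "i \<le> L" "u i \<noteq> 0" "\<forall>j\<in>{1..L}. (\<Sum>k\<le>L. u k * b j k) = 0"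
      using ex[of "\<lambda>_. 0"] by blast
    obtain v where v: "\<exists>k\<le>L. v k \<noteq> 0" "(\<Sum>k\<le>L. v k * (if k = i then 1 else 0)) = 0"
        "\<forall>j\<in>{1..L}. (\<Sum>k\<le>L. v k * b j k) = 0"
      using ex[of "\<lambda>k. if k = i then 1 else 0"] by blast
    have "v i = 0" using v(2) u(1) by (simp add: if_distrib[of "(*) _"] cong: if_cong)
    with line[rule_format, of u v i] u v show False by blast
  qed
  with det ker show ?thesis
    unfolding M_def by (intro exI[of _ h]) blast
qed

section \<open>Partial fractions with simple poles\<close>

text \<open>Divide \<open>r\<close> by the product of the \<open>[:1, - \<beta> j:]\<close>, which
  has degree \<open>L\<close> because the \<open>\<beta> j\<close> are nonzero, and interpolate the
  remainder. The bound on \<open>q\<close> is conditional because for \<open>n = L\<close> it has to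
  express \<open>q = 0\<close>.\<close>

lemma partial_fractions:
  fixes r :: "'a :: field poly" and \<beta> :: "nat \<Rightarrow> 'a"
  assumes "inj_on \<beta> {1..L}" "\<And>j. j \<in> {1..L} \<Longrightarrow> \<beta> j \<noteq> 0" "L \<le> n" "degree r < n"
  obtains q e where "q \<noteq> 0 \<Longrightarrow> degree q < n - L"
    "r = q * (\<Prod>j=1..L. [:1, - \<beta> j:]) + (\<Sum>j=1..L. Polynomial.smult (e j) (\<Prod>i\<in>{1..L}-{j}. [:1, - \<beta> i:]))"
proof -
  define d where "d = (\<Prod>j=1..L. [:1, - \<beta> j:])"
  define dj where "dj j = (\<Prod>i\<in>{1..L}-{j}. [:1, - \<beta> i:])" for j
  have dd: "degree d = L"
    unfolding d_def using assms(2) by (subst degree_prod_eq_sum_degree) auto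
  have "d \<noteq> 0" unfolding d_def using assms(2) by auto
  define q where "q = r div d"
  define s where "s = r mod d"
  have r: "r = q * d + s" by (simp add: q_def s_def)
  have s: "s = 0 \<or> degree s < L"
    using degree_mod_less[OF \<open>d \<noteq> 0\<close>, of r] by (simp add: s_def dd)
  have q: "degree q < n - L" if "q \<noteq> 0"
  proof -
    have "L + degree q = degree (q * d)" using that \<open>d \<noteq> 0\<close> by (simp add: degree_mult_eq dd)
    also have "q * d = r - s" using r by simp
    also have "degree (r - s) < n"
      by (rule degree_diff_less) (use s assms(3,4) in auto)
    finally show ?thesis by simp
  qed
  \<comment> \<open>Lagrange interpolation of the remainder at the roots of the denominator.\<close>
  define e where "e j = poly s (1 / \<beta> j) / poly (dj j) (1 / \<beta> j)" for j
  define t where "t = s - (\<Sum>j=1..L. Polynomial.smult (e j) (dj j))"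
  have ne: "poly (dj j) (1 / \<beta> j) \<noteq> 0" if "j \<in> {1..L}" for j
  proof -
    have "1 - \<beta> i / \<beta> j \<noteq> 0" if "i \<in> {1..L} - {j}" for i
      using that \<open>j \<in> {1..L}\<close> inj_onD[OF assms(1), of i j] assms(2)[of j] by auto
    then have "(\<Prod>i\<in>{1..L} - {j}. 1 - \<beta> i / \<beta> j) \<noteq> 0"
      unfolding prod_zero_iff[OF finite_Diff[OF finite_atLeastAtMost]] by blast
    then show ?thesis by (simp add: dj_def poly_prod)
  qed
  have root: "poly t (1 / \<beta> i) = 0" if i: "i \<in> {1..L}" for i
  proof -
    have "poly (dj j) (1 / \<beta> i) = 0" if "j \<in> {1..L} - {i}" for j
      unfolding dj_def poly_prod using that i assms(2)[OF i]
      by (intro prod_zero bexI[of _ i]) auto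
    then have "(\<Sum>j=1..L. e j * poly (dj j) (1 / \<beta> i)) = e i * poly (dj i) (1 / \<beta> i)"
      using i by (subst sum.remove[of _ i]) auto
    then show ?thesis
      using ne[OF i] by (simp add: t_def poly_sum e_def)
  qed
  \<comment> \<open>A nonzero \<open>t\<close> would have degree below \<open>L\<close> but the
    \<open>L\<close> distinct roots \<open>1 / \<beta> j\<close>.\<close>
  have "t = 0"
  proof (rule ccontr)
    assume "t \<noteq> 0"
    have "degree (dj j) \<le> L - 1" if "j \<in> {1..L}" for j
      unfolding dj_def using that assms(2)
      by (subst degree_prod_eq_sum_degree) auto
    then have "degree (\<Sum>j=1..L. Polynomial.smult (e j) (dj j)) \<le> L - 1"
      by (intro degree_sum_le order_trans[OF degree_smult_le]) auto
    \<comment> \<open>For \<open>L = 0\<close> both \<open>s\<close> and the sum vanish, hence also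
      \<open>t\<close>. So the bound \<open>L - 1\<close> is not truncated.\<close>
    moreover have "L \<noteq> 0" using s \<open>t \<noteq> 0\<close> by (auto simp: t_def intro!: Nat.gr0I)
    ultimately have "degree t < L"
      unfolding t_def using s by (intro degree_diff_less) auto
    moreover have "card ((\<lambda>j. 1 / \<beta> j) ` {1..L}) \<le> degree t"
      by (rule order_trans[OF card_mono card_poly_roots_bound[OF \<open>t \<noteq> 0\<close>]])
         (use root poly_roots_finite[OF \<open>t \<noteq> 0\<close>] in auto)
    moreover have "card ((\<lambda>j. 1 / \<beta> j) ` {1..L}) = L"
    proof -
      have "inj_on (\<lambda>j. 1 / \<beta> j) {1..L}"
      proof (rule inj_onI)
        fix i j assume ij: "i \<in> {1..L}" "j \<in> {1..L}" "1 / \<beta> i = 1 / \<beta> j"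
        from ij(3) have "\<beta> i = \<beta> j" by simp
        then show "i = j" by (rule inj_onD[OF assms(1) _ ij(1,2)])
      qed
      then show ?thesis by (simp add: card_image)
    qed
    ultimately show False by simp
  qed
  then have "r = q * d + (\<Sum>j=1..L. Polynomial.smult (e j) (dj j))"
    using r by (simp add: t_def)
  with q show thesis using that unfolding d_def dj_def by blast
qed

section \<open>Integrands in \<open>1 / \<zeta>\<close> and the change to the modified
  weight\<close>

lemma continuous_on_sphere_reciprocal:
  "continuous_on (sphere 0 1) (\<lambda>\<zeta> :: complex. poly q (1 / \<zeta>))"
  by (intro continuous_on_poly continuous_intros) auto

lemma continuous_on_sphere_cauchy:
  assumes "z \<notin> sphere 0 1"
  shows "continuous_on (sphere 0 1) (\<lambda>\<zeta> :: complex. 1 / (1 - z / \<zeta>))"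
  using assms by (intro continuous_intros) (auto simp: field_simps)

text \<open>Conditions are imposed only at the nonzero coefficients of \<open>q\<close>, so the zero
  polynomial is covered without a degree bound.\<close>

lemma pairing_reciprocal_poly_eq_0:
  assumes "weight w" "continuous_on (sphere 0 1) f"
    and "\<And>i. coeff q i \<noteq> 0 \<Longrightarrow> pairing w (\<lambda>\<zeta>. f \<zeta> * (1 / \<zeta>) ^ i) = 0"
  shows "pairing w (\<lambda>\<zeta>. f \<zeta> * poly q (1 / \<zeta>)) = 0"
proof -
  have "pairing w (\<lambda>\<zeta>. f \<zeta> * poly q (1 / \<zeta>))
      = pairing w (\<lambda>\<zeta>. \<Sum>i\<le>degree q. coeff q i * (f \<zeta> * (1 / \<zeta>) ^ i))"
    by (simp only: poly_altdef sum_distrib_left mult.left_commute)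
  also have "\<dots> = (\<Sum>i\<le>degree q. coeff q i * pairing w (\<lambda>\<zeta>. f \<zeta> * (1 / \<zeta>) ^ i))"
    by (intro pairing_sum assms(1) continuous_intros assms(2)) auto
  also have "\<dots> = 0"
    using assms(3) by (intro sum.neutral) auto
  finally show ?thesis .
qed

lemma denom_factor_eq_poly: "denom_factor L \<beta> z = poly (\<Prod>j=1..L. [:1, - \<beta> j:]) (1 / z)"
  by (simp add: denom_factor_def poly_prod inverse_eq_divide)

lemma denom_factor_nonzero:
  assumes "\<And>j. j \<in> {1..L} \<Longrightarrow> \<beta> j \<notin> sphere 0 1" "\<zeta> \<in> sphere 0 1"
  shows "denom_factor L \<beta> \<zeta> \<noteq> 0"
proof -
  have "1 - \<beta> j * inverse \<zeta> \<noteq> 0" if "j \<in> {1..L}" for j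
    using assms(1)[OF that] assms(2) by (auto simp: field_simps)
  then show ?thesis by (simp add: denom_factor_def)
qed

lemma pairing_modified_weight:
  "pairing (modified_weight w L \<beta>) f = pairing w (\<lambda>\<zeta>. f \<zeta> * (1 / denom_factor L \<beta> \<zeta>))"
  by (simp add: pairing_def modified_weight_def)

text \<open>The denominator has no zeros on the circle, so it can be multiplied back in.\<close>

lemma pairing_eq_modified_weight:
  assumes "\<And>j. j \<in> {1..L} \<Longrightarrow> \<beta> j \<notin> sphere 0 1"
  shows "pairing w f = pairing (modified_weight w L \<beta>) (\<lambda>\<zeta>. f \<zeta> * denom_factor L \<beta> \<zeta>)"
  unfolding pairing_modified_weight
  by (rule pairing_cong) (use denom_factor_nonzero[OF assms] in auto)

lemma weight_modified_weight:
  assumes "weight w" "\<And>j. j \<in> {1..L} \<Longrightarrow> \<beta> j \<notin> sphere 0 1"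
  shows "weight (modified_weight w L \<beta>)"
proof -
  have "continuous_on (sphere 0 1) (\<lambda>\<zeta>. 1 / denom_factor L \<beta> \<zeta>)"
    using denom_factor_nonzero[OF assms(2)]
    by (intro continuous_intros) (auto simp: denom_factor_eq_poly intro!: continuous_on_sphere_reciprocal)
  from weight_mult[OF assms(1) this] show ?thesis
    by (simp add: modified_weight_def[abs_def])
qed

section \<open>The determinant representation for one family of polynomials\<close>

text \<open>
  The factor \<open>g\<close> accommodates the two prefactors \<open>2\<close> and \<open>-2 z\<close> of the plain and the starred
  associated functions.
\<close>
lemma casorati_representation:
  fixes v :: "complex \<Rightarrow> complex" and \<beta> :: "nat \<Rightarrow> complex" and a :: "nat \<Rightarrow> complex poly" and L n :: nat
    and x :: "nat \<Rightarrow> complex \<Rightarrow> complex" and X g :: "complex \<Rightarrow> complex"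
  defines "v' \<equiv> modified_weight v L \<beta>"
  assumes v: "weight v" and Ln: "L \<le> n" and inj: "inj_on \<beta> {1..L}"
    and \<beta>: "\<And>j. j \<in> {1..L} \<Longrightarrow> \<beta> j \<noteq> 0 \<and> \<beta> j \<notin> sphere 0 1"
    and a: "\<And>m. degree (a m) = m" "\<And>m. a m \<noteq> 0"
    and orth: "\<And>m k. k < m \<Longrightarrow> pairing v (\<lambda>\<zeta>. poly (a m) \<zeta> * (1 / \<zeta>) ^ k) = 0"
    and orth': "\<And>k. k < n \<Longrightarrow> pairing v' (\<lambda>\<zeta>. poly A \<zeta> * (1 / \<zeta>) ^ k) = 0"
    and uniq: "\<And>p. degree p \<le> n \<Longrightarrow>
        (\<And>k. k < n \<Longrightarrow> pairing v' (\<lambda>\<zeta>. poly p \<zeta> * (1 / \<zeta>) ^ k) = 0) \<Longrightarrow> \<exists>c. p = Polynomial.smult c A"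
    and g: "\<And>z. z \<noteq> 0 \<Longrightarrow> g z \<noteq> 0"
    and x: "\<And>m z. z \<noteq> 0 \<Longrightarrow> z \<notin> sphere 0 1 \<Longrightarrow>
        x m z = g z * pairing v (\<lambda>\<zeta>. poly (a m) \<zeta> * (1 / (1 - z / \<zeta>)))"
    and X: "\<And>z. z \<noteq> 0 \<Longrightarrow> z \<notin> sphere 0 1 \<Longrightarrow>
        X z = g z * pairing v' (\<lambda>\<zeta>. poly A \<zeta> * (1 / (1 - z / \<zeta>)))"
  shows "\<exists>C. (\<forall>z. poly A z = C * casorati_det L n \<beta> (\<lambda>m. poly (a m)) x z) \<and>
    (\<forall>z. z \<noteq> 0 \<and> z \<notin> sphere 0 1 \<longrightarrow> denom_factor L \<beta> z * X z = C * casorati_det L n \<beta> x x z)"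
proof -
  define d where "d = (\<Prod>j=1..L. [:1, - \<beta> j:])"
  have \<beta>': "\<And>j. j \<in> {1..L} \<Longrightarrow> \<beta> j \<noteq> 0" "\<And>j. j \<in> {1..L} \<Longrightarrow> \<beta> j \<notin> sphere 0 1"
    using \<beta> by auto
  have v': "weight v'" unfolding v'_def by (rule weight_modified_weight[OF v \<beta>'(2)])
  \<comment> \<open>A coefficient vector \<open>c\<close> stands for a combination
    \<open>ps c\<close> of the polynomials in the window; the \<open>b j\<close> are rows 1 to
    \<open>L\<close> of the determinant.\<close>
  define ps where "ps c = (\<Sum>k\<le>L. Polynomial.smult (c k) (a (n - L + k)))" for c :: "nat \<Rightarrow> complex"
  define b where "b j k = \<beta> j powi (- int n) * x (n - L + k) (\<beta> j)" for j k
  have ps_pairing: "pairing v (\<lambda>\<zeta>. poly (ps c) \<zeta> * f \<zeta>)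
      = (\<Sum>k\<le>L. c k * pairing v (\<lambda>\<zeta>. poly (a (n - L + k)) \<zeta> * f \<zeta>))"
    if f: "continuous_on (sphere 0 1) f" for c f
  proof -
    have "pairing v (\<lambda>\<zeta>. poly (ps c) \<zeta> * f \<zeta>)
        = pairing v (\<lambda>\<zeta>. \<Sum>k\<le>L. c k * (poly (a (n - L + k)) \<zeta> * f \<zeta>))"
      by (simp add: ps_def poly_sum sum_distrib_right mult.assoc)
    also have "\<dots> = (\<Sum>k\<le>L. c k * pairing v (\<lambda>\<zeta>. poly (a (n - L + k)) \<zeta> * f \<zeta>))"
      by (intro pairing_sum v continuous_intros f) auto
    finally show ?thesis .
  qed
  have ps_assoc: "(\<Sum>k\<le>L. c k * x (n - L + k) z) = g z * pairing v (\<lambda>\<zeta>. poly (ps c) \<zeta> * (1 / (1 - z / \<zeta>)))"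
    if "z \<noteq> 0" "z \<notin> sphere 0 1" for c z
    unfolding ps_pairing[OF continuous_on_sphere_cauchy[OF that(2)]] sum_distrib_left
    by (rule sum.cong) (simp_all add: x[OF that] mult.left_commute)
  have ps_0: "c k = 0" if "ps c = 0" "k \<le> L" for c k
    using poly_independent[of a, OF a] that unfolding ps_def by blast
  \<comment> \<open>Every solution of the linear system yields a polynomial satisfying the
    orthogonality relations of the modified weight, hence a multiple of \<open>A\<close>.\<close>
  have ker: "\<exists>\<mu>. ps c = Polynomial.smult \<mu> A"
    if c: "\<And>j. j \<in> {1..L} \<Longrightarrow> (\<Sum>k\<le>L. c k * b j k) = 0" for c
  proof (rule uniq)
    show "degree (ps c) \<le> n"
      unfolding ps_def using Ln
      by (intro degree_sum_le) (auto intro!: order_trans[OF degree_smult_le] simp: a(1))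
    \<comment> \<open>The power of \<open>\<beta> j\<close> and the factor
      \<open>g (\<beta> j)\<close> are nonzero and cancel.\<close>
    have pole: "pairing v (\<lambda>\<zeta>. poly (ps c) \<zeta> * (1 / (1 - \<beta> j / \<zeta>))) = 0" if j: "j \<in> {1..L}" for j
    proof -
      have "(\<Sum>k\<le>L. c k * b j k) = \<beta> j powi (- int n) * (\<Sum>k\<le>L. c k * x (n - L + k) (\<beta> j))"
        by (simp add: b_def sum_distrib_left mult.left_commute)
      then have "(\<Sum>k\<le>L. c k * x (n - L + k) (\<beta> j)) = 0"
        using c[OF j] \<beta>'(1)[OF j] by simp
      then show ?thesis
        using ps_assoc[of "\<beta> j" c] \<beta>[OF j] g by simp
    qed
    fix k assume "k < n"
    then have "degree (Polynomial.monom (1::complex) k) < n" by (simp add: degree_monom_eq)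
    then obtain q e where q: "q \<noteq> 0 \<Longrightarrow> degree q < n - L"
      and eq: "Polynomial.monom 1 k = q * d + (\<Sum>j=1..L. Polynomial.smult (e j) (\<Prod>i\<in>{1..L}-{j}. [:1, - \<beta> i:]))"
      using partial_fractions[OF inj \<beta>'(1) Ln] unfolding d_def by blast
    \<comment> \<open>Dividing \<open>eq\<close>, evaluated at \<open>1 / \<zeta>\<close>, by the
      denominator leaves a polynomial part of degree below \<open>n - L\<close> and simple poles.
      The first is handled by \<open>orth\<close>, the second by \<open>pole\<close>.\<close>
    have split: "(1 / \<zeta>) ^ k * (1 / denom_factor L \<beta> \<zeta>)
        = poly q (1 / \<zeta>) + (\<Sum>j=1..L. e j * (1 / (1 - \<beta> j / \<zeta>)))" if \<zeta>: "\<zeta> \<in> sphere 0 1" for \<zeta>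
    proof -
      have ne: "1 - \<beta> j / \<zeta> \<noteq> 0" if "j \<in> {1..L}" for j
        using \<beta>'(2)[OF that] \<zeta> by (auto simp: field_simps)
      have dn: "denom_factor L \<beta> \<zeta> = poly d (1 / \<zeta>)" by (simp add: d_def denom_factor_eq_poly)
      have nz: "poly d (1 / \<zeta>) \<noteq> 0" using denom_factor_nonzero[where L = L and \<beta> = \<beta>, OF \<beta>'(2) \<zeta>] dn by simp
      have "poly (\<Prod>i\<in>{1..L}-{j}. [:1, - \<beta> i:]) (1 / \<zeta>) = poly d (1 / \<zeta>) / (1 - \<beta> j / \<zeta>)"
        if j: "j \<in> {1..L}" for j
      proof -
        have "d = [:1, - \<beta> j:] * (\<Prod>i\<in>{1..L}-{j}. [:1, - \<beta> i:])"
          unfolding d_def by (rule prod.remove) (use j in auto)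
        from arg_cong[OF this, of "\<lambda>p. poly p (1 / \<zeta>)"]
        have "poly d (1 / \<zeta>) = (1 - \<beta> j / \<zeta>) * poly (\<Prod>i\<in>{1..L}-{j}. [:1, - \<beta> i:]) (1 / \<zeta>)"
          unfolding poly_mult by simp
        then show ?thesis using ne[OF j] by simp
      qed
      then have "(1 / \<zeta>) ^ k = poly q (1 / \<zeta>) * poly d (1 / \<zeta>)
          + (\<Sum>j=1..L. e j * (poly d (1 / \<zeta>) / (1 - \<beta> j / \<zeta>)))"
        using arg_cong[OF eq, of "\<lambda>p. poly p (1 / \<zeta>)"] by (simp add: poly_sum poly_monom)
      also have "(\<Sum>j=1..L. e j * (poly d (1 / \<zeta>) / (1 - \<beta> j / \<zeta>)))
          = (\<Sum>j=1..L. e j * (1 / (1 - \<beta> j / \<zeta>))) * poly d (1 / \<zeta>)"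
        by (simp add: sum_distrib_right)
      finally show ?thesis
        using nz by (simp add: dn add_divide_distrib)
    qed
    have cont: "continuous_on (sphere 0 1) (\<lambda>\<zeta>. 1 / (1 - \<beta> j / \<zeta>))" if "j \<in> {1..L}" for j
      by (rule continuous_on_sphere_cauchy[OF \<beta>'(2)[OF that]])
    have "pairing v' (\<lambda>\<zeta>. poly (ps c) \<zeta> * (1 / \<zeta>) ^ k)
        = pairing v (\<lambda>\<zeta>. poly (ps c) \<zeta> * poly q (1 / \<zeta>)
            + (\<Sum>j=1..L. e j * (poly (ps c) \<zeta> * (1 / (1 - \<beta> j / \<zeta>)))))"
      unfolding v'_def pairing_modified_weight
    proof (rule pairing_cong)
      fix \<zeta> :: complex assume "\<zeta> \<in> sphere 0 1"
      from split[OF this]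
      show "poly (ps c) \<zeta> * (1 / \<zeta>) ^ k * (1 / denom_factor L \<beta> \<zeta>)
          = poly (ps c) \<zeta> * poly q (1 / \<zeta>) + (\<Sum>j=1..L. e j * (poly (ps c) \<zeta> * (1 / (1 - \<beta> j / \<zeta>))))"
        by (simp only: mult.assoc distrib_left sum_distrib_left mult.left_commute)
    qed
    also have "\<dots> = pairing v (\<lambda>\<zeta>. poly (ps c) \<zeta> * poly q (1 / \<zeta>))
        + pairing v (\<lambda>\<zeta>. \<Sum>j=1..L. e j * (poly (ps c) \<zeta> * (1 / (1 - \<beta> j / \<zeta>))))"
      by (intro pairing_add v continuous_intros continuous_on_sphere_reciprocal cont) auto
    also have "pairing v (\<lambda>\<zeta>. poly (ps c) \<zeta> * poly q (1 / \<zeta>)) = 0"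
    proof (intro pairing_reciprocal_poly_eq_0 v continuous_intros)
      fix i assume "coeff q i \<noteq> 0"
      then have "i < n - L" using q le_degree[of q i] by fastforce
      moreover have "continuous_on (sphere 0 1) (\<lambda>\<zeta>::complex. (1 / \<zeta>) ^ i)"
        using continuous_on_sphere_reciprocal[of "Polynomial.monom 1 i"] by (simp add: poly_monom)
      ultimately show "pairing v (\<lambda>\<zeta>. poly (ps c) \<zeta> * (1 / \<zeta>) ^ i) = 0"
        by (simp add: ps_pairing orth del: power_one_over)
    qed
    also have "pairing v (\<lambda>\<zeta>. \<Sum>j=1..L. e j * (poly (ps c) \<zeta> * (1 / (1 - \<beta> j / \<zeta>)))) = 0"
    proof -
      have "pairing v (\<lambda>\<zeta>. \<Sum>j=1..L. e j * (poly (ps c) \<zeta> * (1 / (1 - \<beta> j / \<zeta>))))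
          = (\<Sum>j=1..L. e j * pairing v (\<lambda>\<zeta>. poly (ps c) \<zeta> * (1 / (1 - \<beta> j / \<zeta>))))"
        by (intro pairing_sum v finite_atLeastAtMost continuous_on_mult cont)
           (auto intro!: continuous_intros)
      also have "\<dots> = 0"
        by (intro sum.neutral ballI) (simp only: pole mult_zero_right)
      finally show ?thesis .
    qed
    finally show "pairing v' (\<lambda>\<zeta>. poly (ps c) \<zeta> * (1 / \<zeta>) ^ k) = 0" by simp
  qed
  \<comment> \<open>The two solutions give the multiples \<open>\<mu>\<close> and
    \<open>\<nu>\<close> of \<open>A\<close>. The combination
    \<open>\<mu> * s k - \<nu> * u k\<close> is therefore sent to zero by \<open>ps\<close> and
    vanishes by independence; its entry at \<open>i\<close> forces \<open>\<nu> = 0\<close>.\<close>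
  have line: "\<forall>k\<le>L. s k = 0"
    if u: "\<forall>j\<in>{1..L}. (\<Sum>k\<le>L. u k * b j k) = 0"
      and s: "\<forall>j\<in>{1..L}. (\<Sum>k\<le>L. s k * b j k) = 0"
      and i: "i \<le> L" "u i \<noteq> 0" "s i = 0" for u s i
  proof -
    obtain \<mu> where \<mu>: "ps u = Polynomial.smult \<mu> A" using ker u by blast
    obtain \<nu> where \<nu>: "ps s = Polynomial.smult \<nu> A" using ker s by blast
    have "\<mu> \<noteq> 0" using \<mu> ps_0[of u i] i by auto
    have "ps (\<lambda>k. \<mu> * s k - \<nu> * u k) = Polynomial.smult \<mu> (ps s) - Polynomial.smult \<nu> (ps u)"
      by (rule poly_eqI) (simp add: ps_def coeff_sum sum_distrib_left sum_subtractf left_diff_distrib mult.assoc)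
    also have "\<dots> = 0" by (simp add: \<mu> \<nu> mult.commute)
    finally have *: "\<mu> * s k - \<nu> * u k = 0" if "k \<le> L" for k
      using ps_0 that by blast
    from *[OF i(1)] i have "\<nu> = 0" by simp
    with * \<open>\<mu> \<noteq> 0\<close> show ?thesis by simp
  qed
  have "\<forall>u s i. (\<forall>j\<in>{1..L}. (\<Sum>k\<le>L. u k * b j k) = 0) \<longrightarrow>
      (\<forall>j\<in>{1..L}. (\<Sum>k\<le>L. s k * b j k) = 0) \<longrightarrow> i \<le> L \<longrightarrow> u i \<noteq> 0 \<longrightarrow> s i = 0 \<longrightarrow>
      (\<forall>k\<le>L. s k = 0)"
    by (intro allI impI) (rule line[THEN spec, THEN mp])
  from det_row_zero_cofactors[OF this] obtain h
    where det: "\<forall>r. Determinant.det (Matrix.mat (L + 1) (L + 1)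
        (\<lambda>(j, k). if j = 0 then r k else b j k)) = (\<Sum>k\<le>L. h k * r k)"
      and h: "\<forall>j\<in>{1..L}. (\<Sum>k\<le>L. h k * b j k) = 0" and "\<exists>k\<le>L. h k \<noteq> 0"
    by blast
  obtain \<mu> where \<mu>: "ps h = Polynomial.smult \<mu> A" using ker h by blast
  have "\<mu> \<noteq> 0" using \<mu> ps_0[of h] \<open>\<exists>k\<le>L. h k \<noteq> 0\<close> by auto
  have cas: "casorati_det L n \<beta> f x z = (\<Sum>k\<le>L. h k * f (n - L + k) z)" for f z
    unfolding casorati_det_def b_def[symmetric] by (rule det[rule_format])
  have "casorati_det L n \<beta> (\<lambda>m. poly (a m)) x z = poly (ps h) z" for z
    by (simp add: cas ps_def poly_sum)
  then have A: "poly A z = 1 / \<mu> * casorati_det L n \<beta> (\<lambda>m. poly (a m)) x z" for z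
    using \<mu> \<open>\<mu> \<noteq> 0\<close> by simp
  have "denom_factor L \<beta> z * X z = 1 / \<mu> * casorati_det L n \<beta> x x z"
    if z: "z \<noteq> 0" "z \<notin> sphere 0 1" for z
  proof -
    \<comment> \<open>The factor theorem at \<open>1 / z\<close>, rescaled by
      \<open>- (1 / z)\<close>, makes \<open>1 - z / \<zeta>\<close> divide the difference of the
      denominator at \<open>\<zeta>\<close> and at \<open>z\<close>.\<close>
    have "poly (d - [:poly d (1 / z):]) (1 / z) = 0" by simp
    then have "[:- (1 / z), 1:] dvd d - [:poly d (1 / z):]" using poly_eq_0_iff_dvd by blast
    then obtain e' where "d - [:poly d (1 / z):] = [:- (1 / z), 1:] * e'" by (auto elim: dvdE)
    then have e': "d - [:poly d (1 / z):] = [:1, - z:] * Polynomial.smult (- (1 / z)) e'"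
      using z by (simp add: field_simps)
    define e where "e = Polynomial.smult (- (1 / z)) e'"
    have e: "d - [:poly d (1 / z):] = [:1, - z:] * e" unfolding e_def by (rule e')
    have "degree d \<le> L"
      unfolding d_def using degree_prod_sum_le[of "{1..L}" "\<lambda>j. [:1, - \<beta> j:]"]
      by (rule order_trans) (auto intro!: order_trans[OF sum_bounded_above[of _ _ 1]])
    then have "degree ([:1, - z:] * e) \<le> L" unfolding e[symmetric] by (simp add: degree_diff_le)
    \<comment> \<open>The quotient loses one degree, so it has degree at most \<open>L - 1\<close>,
      which is below \<open>n\<close>; hence \<open>orth'\<close> annihilates its
      contribution.\<close>
    then have deg_e: "degree e < n" if "e \<noteq> 0"
      using that z Ln by (simp add: degree_mult_eq del: mult_pCons_left)
    have cont: "continuous_on (sphere 0 1) (\<lambda>\<zeta>. 1 / (1 - z / \<zeta>))"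
      by (rule continuous_on_sphere_cauchy[OF z(2)])
    have dn: "denom_factor L \<beta> y = poly d (1 / y)" for y by (simp add: d_def denom_factor_eq_poly)
    have "pairing v (\<lambda>\<zeta>. poly A \<zeta> * (1 / (1 - z / \<zeta>)))
        = pairing v' (\<lambda>\<zeta>. poly A \<zeta> * poly e (1 / \<zeta>) + denom_factor L \<beta> z * (poly A \<zeta> * (1 / (1 - z / \<zeta>))))"
      unfolding v'_def
    proof (rule trans[OF pairing_eq_modified_weight[where L = L and \<beta> = \<beta>] pairing_cong])
      show "\<beta> j \<notin> sphere 0 1" if "j \<in> {1..L}" for j by (rule \<beta>'(2)[OF that])
      fix \<zeta> :: complex assume "\<zeta> \<in> sphere 0 1"
      with z have ne: "1 - z / \<zeta> \<noteq> 0" by (auto simp: field_simps)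
      have "denom_factor L \<beta> \<zeta> - denom_factor L \<beta> z = (1 - z / \<zeta>) * poly e (1 / \<zeta>)"
        using arg_cong[OF e, of "\<lambda>p. poly p (1 / \<zeta>)"] by (simp add: dn algebra_simps)
      then have split: "denom_factor L \<beta> \<zeta> = denom_factor L \<beta> z + (1 - z / \<zeta>) * poly e (1 / \<zeta>)"
        by (simp add: algebra_simps)
      have "a * (1 / t) * (s + t * y) = a * y + s * (a * (1 / t))" if "t \<noteq> 0" for a t s y :: complex
        using that by (simp add: field_simps)
      from this[OF ne]
      show "poly A \<zeta> * (1 / (1 - z / \<zeta>)) * denom_factor L \<beta> \<zeta>
          = poly A \<zeta> * poly e (1 / \<zeta>) + denom_factor L \<beta> z * (poly A \<zeta> * (1 / (1 - z / \<zeta>)))"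
        unfolding split .
    qed
    also have "\<dots> = pairing v' (\<lambda>\<zeta>. poly A \<zeta> * poly e (1 / \<zeta>))
        + denom_factor L \<beta> z * pairing v' (\<lambda>\<zeta>. poly A \<zeta> * (1 / (1 - z / \<zeta>)))"
      unfolding pairing_cmult[symmetric]
      by (intro pairing_add v' continuous_intros continuous_on_sphere_reciprocal cont)
    also have "pairing v' (\<lambda>\<zeta>. poly A \<zeta> * poly e (1 / \<zeta>)) = 0"
    proof (intro pairing_reciprocal_poly_eq_0 v' continuous_intros)
      fix i assume "coeff e i \<noteq> 0"
      then have "i < n" using deg_e le_degree[of e i] by fastforce
      then show "pairing v' (\<lambda>\<zeta>. poly A \<zeta> * (1 / \<zeta>) ^ i) = 0" by (rule orth')
    qed
    finally have key: "g z * pairing v (\<lambda>\<zeta>. poly A \<zeta> * (1 / (1 - z / \<zeta>))) = denom_factor L \<beta> z * X z"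
      by (simp add: X[OF z])
    have "casorati_det L n \<beta> x x z = g z * pairing v (\<lambda>\<zeta>. \<mu> * (poly A \<zeta> * (1 / (1 - z / \<zeta>))))"
      unfolding cas ps_assoc[OF z] \<mu> by (simp add: mult.assoc)
    also have "\<dots> = \<mu> * (denom_factor L \<beta> z * X z)"
      unfolding pairing_cmult key[symmetric] by simp
    finally show ?thesis using \<open>\<mu> \<noteq> 0\<close> by simp
  qed
  with A show ?thesis by blast
qed

section \<open>Orthogonality relations of a biorthogonal system on the circle\<close>

lemma biorthogonal_systemD:
  assumes "biorthogonal_system w \<kappa> \<phi> \<psi>"
  shows "degree (\<phi> n) = n" "degree (\<psi> n) = n" "\<phi> n \<noteq> 0" "\<psi> n \<noteq> 0"
    "coeff (\<phi> n) n = \<kappa> n" "coeff (\<psi> n) n = \<kappa> n" "\<kappa> n \<noteq> 0"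
    "pairing w (\<lambda>\<zeta>. poly (\<phi> m) \<zeta> * poly (\<psi> n) (1 / \<zeta>)) = (if m = n then 1 else 0)"
proof -
  have "(\<kappa> n)\<^sup>2 = toeplitz_det w n / toeplitz_det w (Suc n)" "toeplitz_det w n \<noteq> 0" "toeplitz_det w (Suc n) \<noteq> 0"
    using assms unfolding biorthogonal_system_def by blast+
  then show \<kappa>: "\<kappa> n \<noteq> 0" by auto
  show deg: "degree (\<phi> n) = n" "degree (\<psi> n) = n"
    using assms unfolding biorthogonal_system_def by blast+
  have "lead_coeff (\<phi> n) = \<kappa> n" "lead_coeff (\<psi> n) = \<kappa> n"
    using assms unfolding biorthogonal_system_def by blast+
  then show "coeff (\<phi> n) n = \<kappa> n" "coeff (\<psi> n) n = \<kappa> n" unfolding deg .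
  then show "\<phi> n \<noteq> 0" "\<psi> n \<noteq> 0" using \<kappa> by auto
  show "pairing w (\<lambda>\<zeta>. poly (\<phi> m) \<zeta> * poly (\<psi> n) (1 / \<zeta>)) = (if m = n then 1 else 0)"
    using assms unfolding biorthogonal_system_def pairing_def by (simp only: mult.assoc)
qed

text \<open>The abstract result applies to the form pairing \<open>p\<close> at
  \<open>\<zeta>\<close> with \<open>q\<close> at \<open>1 / \<zeta>\<close>; exchanging its
  arguments gives the two claims on \<open>\<psi>\<close>.\<close>

lemma biorthogonal_system_orthogonal:
  assumes w: "weight w" and b: "biorthogonal_system w \<kappa> \<phi> \<psi>"
  shows "degree q < n \<Longrightarrow> pairing w (\<lambda>\<zeta>. poly (\<phi> n) \<zeta> * poly q (1 / \<zeta>)) = 0"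
    and "degree p \<le> n \<Longrightarrow> (\<And>k. k < n \<Longrightarrow> pairing w (\<lambda>\<zeta>. poly p \<zeta> * (1 / \<zeta>) ^ k) = 0) \<Longrightarrow>
      \<exists>c. p = Polynomial.smult c (\<phi> n)"
    and "degree p < n \<Longrightarrow> pairing w (\<lambda>\<zeta>. poly p \<zeta> * poly (\<psi> n) (1 / \<zeta>)) = 0"
    and "degree q \<le> n \<Longrightarrow> (\<And>k. k < n \<Longrightarrow> pairing w (\<lambda>\<zeta>. \<zeta> ^ k * poly q (1 / \<zeta>)) = 0) \<Longrightarrow>
      \<exists>c. q = Polynomial.smult c (\<psi> n)"
proof -
  define B where "B p q = pairing w (\<lambda>\<zeta>. poly p \<zeta> * poly q (1 / \<zeta>))" for p q
  note cont = continuous_intros continuous_on_sphere_reciprocal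
  have 1: "B (p + p') q = B p q + B p' q" for p p' q
    unfolding B_def poly_add distrib_right by (intro pairing_add w cont)
  have 2: "B (Polynomial.smult c p) q = c * B p q" for c p q
    unfolding B_def poly_smult mult.assoc by (rule pairing_cmult)
  have 3: "B p (q + q') = B p q + B p q'" for p q q'
    unfolding B_def poly_add distrib_left by (intro pairing_add w cont)
  have 4: "B p (Polynomial.smult c q) = c * B p q" for c p q
    unfolding B_def poly_smult mult.left_commute[of "poly p _"] by (rule pairing_cmult)
  have orth: "B (\<phi> m) (\<psi> n) = (if m = n then 1 else 0)" for m n
    unfolding B_def by (rule biorthogonal_systemD[OF b])
  note D = biorthogonal_systemD(1,3)[OF b] biorthogonal_systemD(2,4)[OF b]
  note left = biorthogonal_polys[of B \<phi> \<psi>, OF 1 2 3 4 D orth]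
  have orth': "B (\<phi> n) (\<psi> m) = (if m = n then 1 else 0)" for m n
    using orth[of n m] by auto
  note right = biorthogonal_polys[of "\<lambda>p q. B q p" \<psi> \<phi>, OF 3 4 1 2 D(3,4) D(1,2) orth']
  show "degree q < n \<Longrightarrow> pairing w (\<lambda>\<zeta>. poly (\<phi> n) \<zeta> * poly q (1 / \<zeta>)) = 0"
    using left(1) unfolding B_def .
  show "degree p < n \<Longrightarrow> pairing w (\<lambda>\<zeta>. poly p \<zeta> * poly (\<psi> n) (1 / \<zeta>)) = 0"
    using right(1) unfolding B_def .
  show "degree p \<le> n \<Longrightarrow> (\<And>k. k < n \<Longrightarrow> pairing w (\<lambda>\<zeta>. poly p \<zeta> * (1 / \<zeta>) ^ k) = 0) \<Longrightarrow>
      \<exists>c. p = Polynomial.smult c (\<phi> n)"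
    using left(2)[of p n] unfolding B_def poly_monom mult_1 .
  show "degree q \<le> n \<Longrightarrow> (\<And>k. k < n \<Longrightarrow> pairing w (\<lambda>\<zeta>. \<zeta> ^ k * poly q (1 / \<zeta>)) = 0) \<Longrightarrow>
      \<exists>c. q = Polynomial.smult c (\<psi> n)"
    using right(2)[of q n] unfolding B_def poly_monom mult_1 .
qed

section \<open>The associated functions as Cauchy transforms\<close>

lemma cauchy_kernel_eq:
  fixes z \<zeta> :: complex
  assumes "\<zeta> \<noteq> 0"
  shows "1 / (1 - z / \<zeta>) = \<zeta> / (\<zeta> - z)"
proof -
  have "1 - z / \<zeta> = (\<zeta> - z) / \<zeta>" using assms by (simp add: diff_divide_distrib)
  then show ?thesis by simp
qed

text \<open>The Herglotz kernel is twice the Cauchy kernel minus 1. The term from 1 vanishes for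
  positive \<open>n\<close> by orthogonality; for \<open>n = 0\<close> it is compensated by the
  \<open>fourier_coeff w 0\<close> in the definition.\<close>

lemma assoc_fun_eq_pairing:
  assumes w: "weight w" and b: "biorthogonal_system w \<kappa> \<phi> \<psi>" and z: "z \<notin> sphere 0 1"
  shows "assoc_fun w \<kappa> \<phi> n z = 2 * pairing w (\<lambda>\<zeta>. poly (\<phi> n) \<zeta> * (1 / (1 - z / \<zeta>)))"
proof -
  note cont = continuous_intros continuous_on_sphere_cauchy[OF z]
  have kernel: "(\<zeta> + z) / (\<zeta> - z) = 2 * (1 / (1 - z / \<zeta>)) - 1" if "\<zeta> \<in> sphere 0 1" for \<zeta>
  proof -
    have "\<zeta> \<noteq> 0" "\<zeta> - z \<noteq> 0" using that z by auto
    then show ?thesis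
      unfolding cauchy_kernel_eq[OF \<open>\<zeta> \<noteq> 0\<close>] by (simp add: field_simps)
  qed
  have "pairing w (\<lambda>\<zeta>. poly (\<phi> n) \<zeta> * ((\<zeta> + z) / (\<zeta> - z)))
      = pairing w (\<lambda>\<zeta>. 2 * (poly (\<phi> n) \<zeta> * (1 / (1 - z / \<zeta>))) - poly (\<phi> n) \<zeta>)"
    by (rule pairing_cong) (simp add: kernel algebra_simps)
  also have "\<dots> = 2 * pairing w (\<lambda>\<zeta>. poly (\<phi> n) \<zeta> * (1 / (1 - z / \<zeta>))) - pairing w (poly (\<phi> n))"
    unfolding pairing_cmult[symmetric] by (intro pairing_diff w cont)
  finally have eq: "pairing w (\<lambda>\<zeta>. poly (\<phi> n) \<zeta> * ((\<zeta> + z) / (\<zeta> - z))) + pairing w (poly (\<phi> n))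
      = 2 * pairing w (\<lambda>\<zeta>. poly (\<phi> n) \<zeta> * (1 / (1 - z / \<zeta>)))" by simp
  show ?thesis
  proof (cases "n = 0")
    case True
    have "poly (\<phi> 0) = (\<lambda>_. \<kappa> 0)"
      using biorthogonal_systemD(1,5)[OF b, of 0] by (auto elim!: degree_eq_zeroE)
    moreover have "circle_mean w = pairing w (\<lambda>_. 1)" by (simp add: pairing_def)
    moreover have "herglotz w z = pairing w (\<lambda>\<zeta>. (\<zeta> + z) / (\<zeta> - z))"
      by (simp add: herglotz_def pairing_def mult.commute)
    ultimately show ?thesis
      unfolding eq[symmetric] unfolding True
      using pairing_cmult[of w "\<kappa> 0" "\<lambda>_. 1"]
      by (simp add: assoc_fun_def fourier_coeff_def pairing_cmult distrib_left del: times_divide_eq_right)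
  next
    case False
    then have "pairing w (poly (\<phi> n)) = 0"
      using biorthogonal_system_orthogonal(1)[OF w b, of 1 n] by simp
    with eq False show ?thesis
      by (simp add: assoc_fun_def pairing_def mult_ac)
  qed
qed

lemma poly_recip:
  assumes "degree (\<psi> n) = n" "\<zeta> \<noteq> 0"
  shows "poly (recip \<psi> n) \<zeta> = \<zeta> ^ n * poly (\<psi> n) (1 / \<zeta>)"
  using assms by (simp add: recip_def poly_reflect_poly_nz inverse_eq_divide)

text \<open>With the weight multiplied by \<open>1 / \<zeta>\<close>, the starred function takes the
  Cauchy form of the plain one up to a prefactor, so one representation result serves both.\<close>

lemma assoc_fun_star_eq_pairing:
  assumes w: "weight w" and b: "biorthogonal_system w \<kappa> \<phi> \<psi>" and z: "z \<notin> sphere 0 1"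
  shows "assoc_fun_star w \<kappa> \<psi> n z
    = - 2 * z * pairing (\<lambda>\<zeta>. w \<zeta> * (1 / \<zeta>)) (\<lambda>\<zeta>. poly (recip \<psi> n) \<zeta> * (1 / (1 - z / \<zeta>)))"
proof -
  note cont = continuous_intros continuous_on_sphere_cauchy[OF z] continuous_on_sphere_reciprocal
  \<comment> \<open>Replacing \<open>z ^ n\<close> by \<open>\<zeta> ^ n\<close> under the integral costs only this polynomial of degree less
    than \<open>n\<close>, which is orthogonal to \<open>\<psi> n\<close>; for \<open>n = 0\<close> it supplies the term \<open>w\<^sub>0\<close>.\<close>
  define t where "t = [:z ^ n:] - Polynomial.smult (2 * z) (\<Sum>i<n. Polynomial.monom (z ^ (n - Suc i)) i)"
  have kernel: "z ^ n * ((\<zeta> + z) / (\<zeta> - z)) = 2 * z * ((1 / \<zeta>) * \<zeta> ^ n * (1 / (1 - z / \<zeta>))) + poly t \<zeta>"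
    if \<zeta>: "\<zeta> \<in> sphere 0 1" for \<zeta>
  proof -
    have ne: "\<zeta> \<noteq> 0" "\<zeta> - z \<noteq> 0" using \<zeta> z by auto
    have t: "poly t \<zeta> = z ^ n - 2 * z * (\<Sum>i<n. z ^ (n - Suc i) * \<zeta> ^ i)"
      by (simp add: t_def poly_sum poly_monom)
    have geometric: "(\<Sum>i<n. z ^ (n - Suc i) * \<zeta> ^ i) = (\<zeta> ^ n - z ^ n) / (\<zeta> - z)"
      using power_diff_sumr2[of \<zeta> n z] ne by simp
    have cauchy: "(1 / \<zeta>) * \<zeta> ^ n * (1 / (1 - z / \<zeta>)) = \<zeta> ^ n / (\<zeta> - z)"
      using ne by (simp add: cauchy_kernel_eq)
    \<comment> \<open>Here \<open>a\<close> and \<open>b\<close> stand for \<open>z ^ n\<close> and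
      \<open>\<zeta> ^ n\<close>.\<close>
    have "a * ((\<zeta> + z) / (\<zeta> - z)) = 2 * z * (b / (\<zeta> - z)) + (a - 2 * z * ((b - a) / (\<zeta> - z)))" for a b
      using ne by (simp add: divide_simps) (simp add: algebra_simps)
    then show ?thesis
      unfolding t geometric cauchy .
  qed
  let ?P = "pairing (\<lambda>\<zeta>. w \<zeta> * (1 / \<zeta>)) (\<lambda>\<zeta>. poly (recip \<psi> n) \<zeta> * (1 / (1 - z / \<zeta>)))"
  let ?R = "\<lambda>\<zeta>. (1 / \<zeta>) * (poly (recip \<psi> n) \<zeta> * (1 / (1 - z / \<zeta>)))"
  have "continuous_on (sphere 0 1) (\<lambda>\<zeta>::complex. 1 / \<zeta>)" by (intro continuous_intros) auto
  note cont = cont this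
  have "z ^ n * pairing w (\<lambda>\<zeta>. poly (\<psi> n) (1 / \<zeta>) * ((\<zeta> + z) / (\<zeta> - z)))
      = pairing w (\<lambda>\<zeta>. 2 * z * ?R \<zeta> + poly t \<zeta> * poly (\<psi> n) (1 / \<zeta>))"
    unfolding pairing_cmult[symmetric]
  proof (rule pairing_cong)
    fix \<zeta> :: complex assume \<zeta>: "\<zeta> \<in> sphere 0 1"
    then have "\<zeta> \<noteq> 0" by auto
    have "z ^ n * (poly (\<psi> n) (1 / \<zeta>) * ((\<zeta> + z) / (\<zeta> - z)))
        = poly (\<psi> n) (1 / \<zeta>) * (z ^ n * ((\<zeta> + z) / (\<zeta> - z)))"
      by (rule mult.left_commute)
    also have "\<dots> = 2 * z * ?R \<zeta> + poly t \<zeta> * poly (\<psi> n) (1 / \<zeta>)"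
      unfolding kernel[OF \<zeta>] poly_recip[OF biorthogonal_systemD(2)[OF b] \<open>\<zeta> \<noteq> 0\<close>]
      by (simp only: mult_ac distrib_left)
    finally show "z ^ n * (poly (\<psi> n) (1 / \<zeta>) * ((\<zeta> + z) / (\<zeta> - z)))
        = 2 * z * ?R \<zeta> + poly t \<zeta> * poly (\<psi> n) (1 / \<zeta>)" .
  qed
  also have "\<dots> = 2 * z * pairing w ?R + pairing w (\<lambda>\<zeta>. poly t \<zeta> * poly (\<psi> n) (1 / \<zeta>))"
    unfolding pairing_cmult[symmetric] by (intro pairing_add w cont)
  finally have eq: "z ^ n * pairing w (\<lambda>\<zeta>. poly (\<psi> n) (1 / \<zeta>) * ((\<zeta> + z) / (\<zeta> - z)))
      = 2 * z * ?P + pairing w (\<lambda>\<zeta>. poly t \<zeta> * poly (\<psi> n) (1 / \<zeta>))"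
    unfolding pairing_weight_mult .
  show ?thesis
  proof (cases "n = 0")
    case True
    have "poly (\<psi> 0) = (\<lambda>_. \<kappa> 0)"
      using biorthogonal_systemD(2,6)[OF b, of 0] by (auto elim!: degree_eq_zeroE)
    moreover have "circle_mean w = pairing w (\<lambda>_. 1)" by (simp add: pairing_def)
    moreover have "herglotz w z = pairing w (\<lambda>\<zeta>. (\<zeta> + z) / (\<zeta> - z))"
      by (simp add: herglotz_def pairing_def mult.commute)
    ultimately have "assoc_fun_star w \<kappa> \<psi> 0 z
        = pairing w (\<lambda>\<zeta>. poly [:1:] \<zeta> * poly (\<psi> 0) (1 / \<zeta>))
          - pairing w (\<lambda>\<zeta>. poly (\<psi> 0) (1 / \<zeta>) * ((\<zeta> + z) / (\<zeta> - z)))"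
      using pairing_cmult[of w "\<kappa> 0" "\<lambda>_. 1"]
      by (simp add: assoc_fun_star_def fourier_coeff_def pairing_cmult right_diff_distrib del: times_divide_eq_right)
    with eq True show ?thesis by (simp add: t_def)
  next
    case False
    have "degree t < n"
      unfolding t_def using False
      by (intro degree_diff_less le_less_trans[OF degree_smult_le] le_less_trans[OF degree_sum_le[of _ _ "n - 1"]])
         (auto intro!: order_trans[OF degree_monom_le])
    then have "pairing w (\<lambda>\<zeta>. poly t \<zeta> * poly (\<psi> n) (1 / \<zeta>)) = 0"
      by (rule biorthogonal_system_orthogonal(3)[OF w b])
    with eq False show ?thesis
      by (simp add: assoc_fun_star_def pairing_def mult_ac)
  qed
qed

text \<open>Reversal turns the conditions on the reciprocal polynomial into those on
  \<open>\<psi> n\<close>: the factor \<open>\<zeta> ^ n\<close> and the extra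
  \<open>1 / \<zeta>\<close> in the weight send the exponent \<open>k\<close> to
  \<open>n - 1 - k\<close>, a permutation of the exponents below \<open>n\<close>.\<close>

lemma recip_orthogonal:
  assumes w: "weight w" and b: "biorthogonal_system w \<kappa> \<phi> \<psi>"
  shows "k < n \<Longrightarrow> pairing (\<lambda>\<zeta>. w \<zeta> * (1 / \<zeta>)) (\<lambda>\<zeta>. poly (recip \<psi> n) \<zeta> * (1 / \<zeta>) ^ k) = 0"
    and "degree p \<le> n \<Longrightarrow>
      (\<And>k. k < n \<Longrightarrow> pairing (\<lambda>\<zeta>. w \<zeta> * (1 / \<zeta>)) (\<lambda>\<zeta>. poly p \<zeta> * (1 / \<zeta>) ^ k) = 0) \<Longrightarrow>
      \<exists>c. p = Polynomial.smult c (recip \<psi> n)"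
proof -
  note D = biorthogonal_systemD[OF b]
  have shift: "pairing (\<lambda>\<zeta>. w \<zeta> * (1 / \<zeta>)) (\<lambda>\<zeta>. poly p \<zeta> * (1 / \<zeta>) ^ k)
      = pairing w (\<lambda>\<zeta>. \<zeta> ^ (n - Suc k) * poly q (1 / \<zeta>))"
    if pq: "\<And>\<zeta>. \<zeta> \<noteq> 0 \<Longrightarrow> poly p \<zeta> = \<zeta> ^ n * poly q (1 / \<zeta>)" and k: "k < n" for p q k
    unfolding pairing_weight_mult
  proof (rule pairing_cong)
    fix \<zeta> :: complex assume "\<zeta> \<in> sphere 0 1"
    then have ne: "\<zeta> \<noteq> 0" by auto
    have "\<zeta> ^ n = \<zeta> ^ (n - Suc k) * \<zeta> ^ k * \<zeta>"
      using k by (simp flip: power_add power_Suc2)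
    then show "1 / \<zeta> * (poly p \<zeta> * (1 / \<zeta>) ^ k) = \<zeta> ^ (n - Suc k) * poly q (1 / \<zeta>)"
      using ne by (simp add: pq power_divide)
  qed
  show "pairing (\<lambda>\<zeta>. w \<zeta> * (1 / \<zeta>)) (\<lambda>\<zeta>. poly (recip \<psi> n) \<zeta> * (1 / \<zeta>) ^ k) = 0" if k: "k < n"
  proof -
    have "pairing (\<lambda>\<zeta>. w \<zeta> * (1 / \<zeta>)) (\<lambda>\<zeta>. poly (recip \<psi> n) \<zeta> * (1 / \<zeta>) ^ k)
      = pairing w (\<lambda>\<zeta>. poly (Polynomial.monom 1 (n - Suc k)) \<zeta> * poly (\<psi> n) (1 / \<zeta>))"
      using shift[OF poly_recip[of \<psi> n] k] D(2) by (simp add: poly_monom)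
    also have "\<dots> = 0"
      using k by (intro biorthogonal_system_orthogonal(3)[OF w b]) (simp add: degree_monom_eq)
    finally show ?thesis .
  qed
  show "\<exists>c. p = Polynomial.smult c (recip \<psi> n)"
    if deg: "degree p \<le> n"
      and p: "\<And>k. k < n \<Longrightarrow> pairing (\<lambda>\<zeta>. w \<zeta> * (1 / \<zeta>)) (\<lambda>\<zeta>. poly p \<zeta> * (1 / \<zeta>) ^ k) = 0"
  proof -
    \<comment> \<open>This reverses \<open>p\<close> as if it had degree \<open>n\<close>; the
      monomial makes up for \<open>reflect_poly\<close> reversing only up to the actual
      degree.\<close>
    define q where "q = Polynomial.monom 1 (n - degree p) * reflect_poly p"
    have "degree q \<le> n"
      unfolding q_def using deg
      by (intro order_trans[OF degree_mult_le])
         (metis add_mono degree_monom_le degree_reflect_poly_le le_add_diff_inverse2)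
    have pq: "poly p \<zeta> = \<zeta> ^ n * poly q (1 / \<zeta>)" if "\<zeta> \<noteq> 0" for \<zeta>
    proof -
      have "\<zeta> ^ n = \<zeta> ^ (n - degree p) * \<zeta> ^ degree p"
        using deg by (simp flip: power_add)
      then show ?thesis
        using that by (simp add: q_def poly_monom poly_reflect_poly_nz power_divide)
    qed
    have "\<exists>c. q = Polynomial.smult c (\<psi> n)"
    proof (rule biorthogonal_system_orthogonal(4)[OF w b \<open>degree q \<le> n\<close>])
      fix k assume "k < n"
      then have "n - Suc k < n" "n - Suc (n - Suc k) = k" by auto
      then show "pairing w (\<lambda>\<zeta>. \<zeta> ^ k * poly q (1 / \<zeta>)) = 0"
        using shift[OF pq, of "n - Suc k"] p[of "n - Suc k"] by simp
    qed
    then obtain c where c: "q = Polynomial.smult c (\<psi> n)" ..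
    \<comment> \<open>Agreement away from 0 suffices, since a nonzero polynomial has finitely many
      roots.\<close>
    have "poly p \<zeta> = poly (Polynomial.smult c (recip \<psi> n)) \<zeta>" if "\<zeta> \<noteq> 0" for \<zeta>
      using that D(2) by (simp add: pq poly_recip c)
    then have "- {0} \<subseteq> {\<zeta>. poly (p - Polynomial.smult c (recip \<psi> n)) \<zeta> = 0}" by auto
    moreover have "infinite (- {0 :: complex})"
      by (simp add: Compl_eq_Diff_UNIV infinite_UNIV_char_0)
    ultimately have "p - Polynomial.smult c (recip \<psi> n) = 0"
      by (metis poly_roots_finite finite_subset)
    then show ?thesis by auto
  qed
qed

section \<open>Determinant formulas for the plain and the starred families\<close>

theorem proposition3p5:
  fixes w :: "complex \<Rightarrow> complex" and L n :: nat and \<beta> :: "nat \<Rightarrow> complex"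
    and \<kappa> \<kappa>' :: "nat \<Rightarrow> complex" and \<phi> \<psi> \<Phi> \<Psi> :: "nat \<Rightarrow> complex poly"
  defines "w' \<equiv> modified_weight w L \<beta>"
  defines "\<xi> \<equiv> assoc_fun w \<kappa> \<phi>" and "\<xi>s \<equiv> assoc_fun_star w \<kappa> \<psi>"
  defines "\<Xi> \<equiv> assoc_fun w' \<kappa>' \<Phi>" and "\<Xi>s \<equiv> assoc_fun_star w' \<kappa>' \<Psi>"
  assumes "weight w"
    and "L \<ge> 1"
    and "inj_on \<beta> {1..L}"
    and "\<And>j. j \<in> {1..L} \<Longrightarrow> \<beta> j \<noteq> 0 \<and> \<beta> j \<notin> sphere 0 1"
    and "biorthogonal_system w \<kappa> \<phi> \<psi>" and "generic_system \<kappa> \<phi> \<psi>"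
    and "biorthogonal_system w' \<kappa>' \<Phi> \<Psi>" and "generic_system \<kappa>' \<Phi> \<Psi>"
    and "n \<ge> L"
  shows "\<exists>C Cs :: complex.
     (\<forall>z. poly (\<Phi> n) z = C * casorati_det L n \<beta> (\<lambda>m. poly (\<phi> m)) \<xi> z) \<and>
     (\<forall>z. poly (recip \<Psi> n) z = Cs * casorati_det L n \<beta> (\<lambda>m. poly (recip \<psi> m)) \<xi>s z) \<and>
     (\<forall>z. z \<noteq> 0 \<and> z \<notin> sphere 0 1 \<longrightarrow>
        denom_factor L \<beta> z * \<Xi> n z = C * casorati_det L n \<beta> \<xi> \<xi> z) \<and>
     (\<forall>z. z \<noteq> 0 \<and> z \<notin> sphere 0 1 \<longrightarrow>
        denom_factor L \<beta> z * \<Xi>s n z = Cs * casorati_det L n \<beta> \<xi>s \<xi>s z)"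
proof -
  note w = \<open>weight w\<close> and b = \<open>biorthogonal_system w \<kappa> \<phi> \<psi>\<close>
    and b' = \<open>biorthogonal_system w' \<kappa>' \<Phi> \<Psi>\<close> and \<beta> = assms(9)
  have w': "weight w'"
    unfolding w'_def by (rule weight_modified_weight[OF w]) (use \<beta> in blast)
  have orth: "pairing u (\<lambda>\<zeta>. poly (P m) \<zeta> * (1 / \<zeta>) ^ k) = 0"
    if "weight u" "biorthogonal_system u l P Q" "k < m" for u l P Q m k
    using biorthogonal_system_orthogonal(1)[OF that(1,2), of "Polynomial.monom 1 k" m] that(3)
    by (simp add: degree_monom_eq poly_monom)
  have plain: "\<exists>C. (\<forall>z. poly (\<Phi> n) z = C * casorati_det L n \<beta> (\<lambda>m. poly (\<phi> m)) \<xi> z) \<and>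
     (\<forall>z. z \<noteq> 0 \<and> z \<notin> sphere 0 1 \<longrightarrow> denom_factor L \<beta> z * \<Xi> n z = C * casorati_det L n \<beta> \<xi> \<xi> z)"
  proof (rule casorati_representation[where v = w and g = "\<lambda>_. 2", OF w \<open>n \<ge> L\<close> \<open>inj_on \<beta> {1..L}\<close> \<beta>])
    show "degree (\<phi> m) = m" "\<phi> m \<noteq> 0" for m
      by (rule biorthogonal_systemD[OF b])+
    show "k < m \<Longrightarrow> pairing w (\<lambda>\<zeta>. poly (\<phi> m) \<zeta> * (1 / \<zeta>) ^ k) = 0" for m k
      by (rule orth[OF w b])
    show "k < n \<Longrightarrow> pairing (modified_weight w L \<beta>) (\<lambda>\<zeta>. poly (\<Phi> n) \<zeta> * (1 / \<zeta>) ^ k) = 0" for k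
      by (rule orth[OF w' b', unfolded w'_def])
    show "\<exists>c. p = Polynomial.smult c (\<Phi> n)" if "degree p \<le> n"
      "\<And>k. k < n \<Longrightarrow> pairing (modified_weight w L \<beta>) (\<lambda>\<zeta>. poly p \<zeta> * (1 / \<zeta>) ^ k) = 0" for p
      using biorthogonal_system_orthogonal(2)[OF w' b' that[folded w'_def]] .
    show "\<xi> m z = 2 * pairing w (\<lambda>\<zeta>. poly (\<phi> m) \<zeta> * (1 / (1 - z / \<zeta>)))"
      if "z \<notin> sphere 0 1" for m z
      unfolding \<xi>_def by (rule assoc_fun_eq_pairing[OF w b that])
    show "\<Xi> n z = 2 * pairing (modified_weight w L \<beta>) (\<lambda>\<zeta>. poly (\<Phi> n) \<zeta> * (1 / (1 - z / \<zeta>)))"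
      if "z \<notin> sphere 0 1" for z
      unfolding \<Xi>_def w'_def[symmetric] by (rule assoc_fun_eq_pairing[OF w' b' that])
  qed simp_all
  define v where "v = (\<lambda>\<zeta>. w \<zeta> * (1 / \<zeta>))"
  have v: "weight v"
    unfolding v_def by (intro weight_mult w continuous_intros) auto
  \<comment> \<open>Modifying the weight commutes with multiplying it by \<open>1 / \<zeta>\<close>,
    so the modified starred system fits the same representation.\<close>
  have v': "modified_weight v L \<beta> = (\<lambda>\<zeta>. w' \<zeta> * (1 / \<zeta>))"
    by (simp add: v_def w'_def modified_weight_def fun_eq_iff)
  \<comment> \<open>Genericity enters here: it gives the reciprocal polynomials full degree.\<close>
  have \<psi>0: "coeff (\<psi> m) 0 \<noteq> 0" for m
  proof (cases "m = 0")
    case True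
    then show ?thesis using biorthogonal_systemD(6,7)[OF b, of 0] by simp
  next
    case False
    then show ?thesis
      using \<open>generic_system \<kappa> \<phi> \<psi>\<close>
      by (auto simp: generic_system_def refl_coeff_def poly_0_coeff_0)
  qed
  \<comment> \<open>The prefactor \<open>- 2 * z\<close> vanishes only at 0, which is excluded for
    \<open>z\<close> and for the \<open>\<beta> j\<close>.\<close>
  have star: "\<exists>C. (\<forall>z. poly (recip \<Psi> n) z = C * casorati_det L n \<beta> (\<lambda>m. poly (recip \<psi> m)) \<xi>s z) \<and>
     (\<forall>z. z \<noteq> 0 \<and> z \<notin> sphere 0 1 \<longrightarrow> denom_factor L \<beta> z * \<Xi>s n z = C * casorati_det L n \<beta> \<xi>s \<xi>s z)"
  proof (rule casorati_representation[where v = v and g = "\<lambda>z. - 2 * z", OF v \<open>n \<ge> L\<close> \<open>inj_on \<beta> {1..L}\<close> \<beta>])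
    show "degree (recip \<psi> m) = m" "recip \<psi> m \<noteq> 0" for m
      using biorthogonal_systemD(2,4)[OF b, of m] \<psi>0[of m] by (simp_all add: recip_def)
    show "k < m \<Longrightarrow> pairing v (\<lambda>\<zeta>. poly (recip \<psi> m) \<zeta> * (1 / \<zeta>) ^ k) = 0" for m k
      unfolding v_def by (rule recip_orthogonal(1)[OF w b])
    show "k < n \<Longrightarrow> pairing (modified_weight v L \<beta>) (\<lambda>\<zeta>. poly (recip \<Psi> n) \<zeta> * (1 / \<zeta>) ^ k) = 0" for k
      unfolding v' by (rule recip_orthogonal(1)[OF w' b'])
    show "\<exists>c. p = Polynomial.smult c (recip \<Psi> n)" if "degree p \<le> n"
      "\<And>k. k < n \<Longrightarrow> pairing (modified_weight v L \<beta>) (\<lambda>\<zeta>. poly p \<zeta> * (1 / \<zeta>) ^ k) = 0" for p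
      using recip_orthogonal(2)[OF w' b' that[unfolded v']] .
    show "\<xi>s m z = - 2 * z * pairing v (\<lambda>\<zeta>. poly (recip \<psi> m) \<zeta> * (1 / (1 - z / \<zeta>)))"
      if "z \<notin> sphere 0 1" for m z
      unfolding v_def \<xi>s_def by (rule assoc_fun_star_eq_pairing[OF w b that])
    show "\<Xi>s n z = - 2 * z * pairing (modified_weight v L \<beta>) (\<lambda>\<zeta>. poly (recip \<Psi> n) \<zeta> * (1 / (1 - z / \<zeta>)))"
      if "z \<notin> sphere 0 1" for z
      unfolding v' \<Xi>s_def by (rule assoc_fun_star_eq_pairing[OF w' b' that])
  qed simp_all
  from plain star show ?thesis by blast
qed

end
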